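(* Consider the $2$-vertex directed graph IFS on the unit interval described in the context, with attractors $F_u,F_v$. If the set $\{g_u,g_v,a,b,c,d\}\subset\mathbb{R}^+$ is multiplicatively rationally independent, then $F_u$ is not the attractor of any standard ($1$-vertex) IFS, defined on $\mathbb{R}$, for which the convex strong separation condition (CSSC) holds.
   Context: The $2$-vertex IFS on the unit interval: $a,g_u,b,c,g_v,d>0$ satisfy $a+g_u+b=1$ and $c+g_v+d=1$. Define $S_{e_1}(x)=ax$, $S_{e_2}(x)=bx+a+g_u$, $S_{e_3}(x)=cx$, $S_{e_4}(x)=dx+c+g_v$ on $\mathbb{R}$. The attractors are the unique non-empty compact sets $F_u,F_v\subset\mathbb{R}$ with $F_u=S_{e_1}(F_u)\cup S_{e_2}(F_v)$ and $F_v=S_{e_3}(F_v)\cup S_{e_4}(F_u)$; both have convex hull $[0,1]$. Multiplicatively rationally independent: a set $\{u_1,\dots,u_r\}$ of positive reals (listed as displayed) is multiplicatively rationally independent if for all integers $m_1,\dots,m_r$, $\prod_{i=1}^r u_i^{m_i}=1$ implies $m_i=0$ for all $i$. In particular the listed numbers are distinct. Standard ($1$-vertex) IFS on $\mathbb{R}$: a finite family $S_1,\dots,S_n$, $n\geq2$, of contracting similarities $S_i:\mathbb{R}\to\mathbb{R}$ (ratios in $(0,1)$, orientation reversal allowed); its attractor is the unique non-empty compact $F\subset\mathbb{R}$ with $F=\bigcup_{i=1}^nS_i(F)$. It satisfies the CSSC if $S_i(C(F))\cap S_j(C(F))=\emptyset$ for all $i\neq j$, where $C(F)$ is the convex hull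 of $F$. *)

theory Defs
  imports "HOL-Analysis.Analysis"
begin

definition contracting_similarity :: "(real \<Rightarrow> real) \<Rightarrow> bool" where
  "contracting_similarity f \<longleftrightarrow>
     (\<exists>r. 0 < r \<and> r < 1 \<and> (\<forall>x y. dist (f x) (f y) = r * dist x y))"

definition standard_IFS :: "nat \<Rightarrow> (nat \<Rightarrow> real \<Rightarrow> real) \<Rightarrow> bool" where
  "standard_IFS n S \<longleftrightarrow> 2 \<le> n \<and> (\<forall>i\<in>{1..n}. contracting_similarity (S i))"

(* For a family of contractions the attractor exists and is unique (Hutchinson), so "the attractor"
   is expressed by the property that determines it. *)
definition is_attractor :: "nat \<Rightarrow> (nat \<Rightarrow> real \<Rightarrow> real) \<Rightarrow> real set \<Rightarrow> bool" where
  "is_attractor n S F \<longleftrightarrow> F \<noteq> {} \<and> compact F \<and> F = (\<Union>i\<in>{1..n}. S i ` F)"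

(* F is meant to be the attractor of the family S. *)
definition CSSC :: "nat \<Rightarrow> (nat \<Rightarrow> real \<Rightarrow> real) \<Rightarrow> real set \<Rightarrow> bool" where
  "CSSC n S F \<longleftrightarrow>
     (\<forall>i\<in>{1..n}. \<forall>j\<in>{1..n}. i \<noteq> j \<longrightarrow> S i ` (convex hull F) \<inter> S j ` (convex hull F) = {})"

(* A list rather than a set: a repeated entry has to make the family dependent. *)
definition mult_rat_independent :: "real list \<Rightarrow> bool" where
  "mult_rat_independent us \<longleftrightarrow>
     (\<forall>u\<in>set us. 0 < u) \<and>
     (\<forall>m :: nat \<Rightarrow> int. (\<Prod>i<length us. (us ! i) powi (m i)) = 1 \<longrightarrow> (\<forall>i<length us. m i = 0))"

definition unit_interval_params :: "real \<Rightarrow> real \<Rightarrow> real \<Rightarrow> real \<Rightarrow> real \<Rightarrow> real \<Rightarrow> bool" where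
  "unit_interval_params a gu b c gv d \<longleftrightarrow>
     0 < a \<and> 0 < gu \<and> 0 < b \<and> 0 < c \<and> 0 < gv \<and> 0 < d \<and> a + gu + b = 1 \<and> c + gv + d = 1"

definition S_e1 :: "real \<Rightarrow> real \<Rightarrow> real" where
  "S_e1 a x = a * x"

definition S_e2 :: "real \<Rightarrow> real \<Rightarrow> real \<Rightarrow> real \<Rightarrow> real" where
  "S_e2 a gu b x = b * x + a + gu"

definition S_e3 :: "real \<Rightarrow> real \<Rightarrow> real" where
  "S_e3 c x = c * x"

definition S_e4 :: "real \<Rightarrow> real \<Rightarrow> real \<Rightarrow> real \<Rightarrow> real" where
  "S_e4 c gv d x = d * x + c + gv"

(* As for the standard IFS, these properties determine the pair (Fu, Fv) uniquely. *)
definition two_vertex_attractors ::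
    "real \<Rightarrow> real \<Rightarrow> real \<Rightarrow> real \<Rightarrow> real \<Rightarrow> real \<Rightarrow> real set \<Rightarrow> real set \<Rightarrow> bool" where
  "two_vertex_attractors a gu b c gv d Fu Fv \<longleftrightarrow>
     Fu \<noteq> {} \<and> compact Fu \<and> Fv \<noteq> {} \<and> compact Fv \<and>
     Fu = S_e1 a ` Fu \<union> S_e2 a gu b ` Fv \<and>
     Fv = S_e3 c ` Fv \<union> S_e4 c gv d ` Fu"

end

theory Submission
  imports Defs
begin

text \<open>
  The proof compares lengths of gaps, the bounded components of the complement of \<open>Fu\<close>.

  A gap of \<open>Fu\<close> is the central gap of length \<open>gu\<close> or lies inside one of the two pieces, and is then
  the image of a gap of \<open>Fu\<close> or \<open>Fv\<close>; similarly for \<open>Fv\<close> (\<open>two_vertex_gap_lengths\<close>).  So the length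
  of a gap is \<open>gu\<close> or \<open>gv\<close> times the product of the ratios along a path of the graph.  A path that
  starts at \<open>u\<close> uses \<open>b\<close> (the edge to \<open>v\<close>) and \<open>d\<close> (the edge back) alternately, and it can use
  the loop \<open>c\<close> at \<open>v\<close> only after \<open>b\<close>.  The lengths are therefore of one of the forms
  \<open>gu * a ^ i * b ^ j * c ^ k * d ^ j\<close>, where \<open>k = 0\<close> if \<open>j = 0\<close>, and
  \<open>gv * a ^ i * b ^ (j + 1) * c ^ k * d ^ j\<close> (\<open>two_vertex_gap_length_monomial\<close>).

  Suppose that \<open>Fu\<close> is the attractor of a standard IFS with the CSSC.  The pieces of \<open>Fu\<close> lie in
  disjoint intervals, so each ratio \<open>r\<close> of the IFS maps the set of gap lengths into itself, and all
  but finitely many gap lengths are such multiples of gap lengths (\<open>CSSC_attractor_gap_lengths\<close>).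
  Since \<open>r * gu\<close> and \<open>r * (b * gv)\<close> are gap lengths, independence forces \<open>r\<close> to be the ratio of a
  closed path at \<open>u\<close>, that is \<open>a ^ i * b ^ j * c ^ k * d ^ j\<close> with \<open>k = 0\<close> if \<open>j = 0\<close>
  (\<open>two_vertex_gap_scaling_monomial\<close>).

  The infinitely many numbers \<open>b * (gv * c ^ n)\<close> are gap lengths, so one of them equals \<open>r * g\<close> for a
  ratio \<open>r\<close> of the IFS and a gap length \<open>g\<close>.  By independence \<open>g\<close> has the second form, which already
  contains the single factor \<open>b\<close>.  Thus \<open>r\<close> has no factor \<open>b\<close>, hence no factor \<open>c\<close>, and it has no
  factor \<open>a\<close> either.  So \<open>r = 1\<close>, a contradiction: the powers of \<open>c\<close> come from the loop at \<open>v\<close>,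
  and self-similarities of \<open>Fu\<close> cannot reproduce them.
\<close>

section \<open>Gap lengths of subsets of the line\<close>

definition gap_lengths :: "real set \<Rightarrow> real set" where
  "gap_lengths F = {y - x |x y. x \<in> F \<and> y \<in> F \<and> x < y \<and> {x<..<y} \<inter> F = {}}"

lemma gap_lengthsI:
  assumes "x \<in> F" "y \<in> F" "x < y" "\<And>z. z \<in> F \<Longrightarrow> x < z \<Longrightarrow> z < y \<Longrightarrow> False"
  shows "y - x \<in> gap_lengths F"
  unfolding gap_lengths_def using assms by fastforce

lemma gap_lengthsE:
  assumes "g \<in> gap_lengths F"
  obtains x y where "g = y - x" "x \<in> F" "y \<in> F" "x < y"
    "\<And>z. z \<in> F \<Longrightarrow> x < z \<Longrightarrow> z < y \<Longrightarrow> False"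
  using assms unfolding gap_lengths_def by fastforce

lemma gap_lengths_affine_image_supset:
  fixes e t :: real
  assumes "e \<noteq> 0" "g \<in> gap_lengths F"
  shows "\<bar>e\<bar> * g \<in> gap_lengths ((\<lambda>x. e * x + t) ` F)"
  using assms(2)
proof (cases rule: gap_lengthsE)
  case (1 x y)
  show ?thesis
  proof (cases "e > 0")
    case True
    have "(e * y + t) - (e * x + t) \<in> gap_lengths ((\<lambda>x. e * x + t) ` F)"
      by (rule gap_lengthsI) (use 1 True in auto)
    with 1 True show ?thesis by (simp add: right_diff_distrib)
  next
    case False
    with assms(1) have e: "e < 0" by simp
    have "(e * x + t) - (e * y + t) \<in> gap_lengths ((\<lambda>x. e * x + t) ` F)"
      by (rule gap_lengthsI) (use 1 e in auto)
    with 1 e show ?thesis by (simp add: right_diff_distrib)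
  qed
qed

text \<open>The converse inclusion is the preceding lemma for the inverse map.\<close>

lemma gap_lengths_affine_image:
  fixes e t :: real
  assumes "e \<noteq> 0"
  shows "gap_lengths ((\<lambda>x. e * x + t) ` F) = (\<lambda>g. \<bar>e\<bar> * g) ` gap_lengths F"
proof
  show "(\<lambda>g. \<bar>e\<bar> * g) ` gap_lengths F \<subseteq> gap_lengths ((\<lambda>x. e * x + t) ` F)"
    using gap_lengths_affine_image_supset[OF assms] by blast
  show "gap_lengths ((\<lambda>x. e * x + t) ` F) \<subseteq> (\<lambda>g. \<bar>e\<bar> * g) ` gap_lengths F"
  proof
    fix g assume g: "g \<in> gap_lengths ((\<lambda>x. e * x + t) ` F)"
    have "(\<lambda>x. inverse e * x + - t / e) ` (\<lambda>x. e * x + t) ` F = F"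
      using assms by (simp add: image_image field_simps)
    with gap_lengths_affine_image_supset[OF _ g, of "inverse e" "- t / e"] assms
    have "\<bar>inverse e\<bar> * g \<in> gap_lengths F" by simp
    moreover have "g = \<bar>e\<bar> * (\<bar>inverse e\<bar> * g)" using assms by simp
    ultimately show "g \<in> (\<lambda>g. \<bar>e\<bar> * g) ` gap_lengths F" by blast
  qed
qed

lemma gap_lengths_Un_separated:
  assumes "\<beta> \<in> A" "\<gamma> \<in> B" "\<beta> < \<gamma>" "A \<subseteq> {..\<beta>}" "B \<subseteq> {\<gamma>..}"
  shows "gap_lengths (A \<union> B) = insert (\<gamma> - \<beta>) (gap_lengths A \<union> gap_lengths B)"
proof
  show "gap_lengths (A \<union> B) \<subseteq> insert (\<gamma> - \<beta>) (gap_lengths A \<union> gap_lengths B)"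
  proof
    fix g assume "g \<in> gap_lengths (A \<union> B)"
    then show "g \<in> insert (\<gamma> - \<beta>) (gap_lengths A \<union> gap_lengths B)"
    proof (cases rule: gap_lengthsE)
      case (1 x y)
      consider "x \<in> A" "y \<in> A" | "x \<in> B" "y \<in> B" | "x \<in> A" "y \<in> B"
        using 1 assms by fastforce
      then show ?thesis
      proof cases
        case 1
        have "y - x \<in> gap_lengths A"
          by (rule gap_lengthsI) (use 1 \<open>x < y\<close> \<open>\<And>z. z \<in> A \<union> B \<Longrightarrow> x < z \<Longrightarrow> z < y \<Longrightarrow> False\<close> in auto)
        then show ?thesis using \<open>g = y - x\<close> by simp
      next
        case 2
        have "y - x \<in> gap_lengths B"
          by (rule gap_lengthsI) (use 2 \<open>x < y\<close> \<open>\<And>z. z \<in> A \<union> B \<Longrightarrow> x < z \<Longrightarrow> z < y \<Longrightarrow> False\<close> in auto)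
        then show ?thesis using \<open>g = y - x\<close> by simp
      next
        case 3
        then have "x \<le> \<beta>" "\<gamma> \<le> y" using assms by auto
        moreover have "\<not> x < \<beta>"
          using 1(5)[of \<beta>] assms \<open>\<gamma> \<le> y\<close> by auto
        moreover have "\<not> \<gamma> < y"
          using 1(5)[of \<gamma>] assms \<open>x \<le> \<beta>\<close> by auto
        ultimately show ?thesis using 1(1) by simp
      qed
    qed
  qed
  have "\<gamma> - \<beta> \<in> gap_lengths (A \<union> B)"
    by (rule gap_lengthsI) (use assms in fastforce)+
  moreover have "gap_lengths A \<subseteq> gap_lengths (A \<union> B)"
  proof
    fix g assume "g \<in> gap_lengths A"
    then show "g \<in> gap_lengths (A \<union> B)"
    proof (cases rule: gap_lengthsE)
      case (1 x y)
      have "y - x \<in> gap_lengths (A \<union> B)"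
        by (rule gap_lengthsI) (use 1 assms in fastforce)+
      with 1 show ?thesis by simp
    qed
  qed
  moreover have "gap_lengths B \<subseteq> gap_lengths (A \<union> B)"
  proof
    fix g assume "g \<in> gap_lengths B"
    then show "g \<in> gap_lengths (A \<union> B)"
    proof (cases rule: gap_lengthsE)
      case (1 x y)
      have "y - x \<in> gap_lengths (A \<union> B)"
        by (rule gap_lengthsI) (use 1 assms in fastforce)+
      with 1 show ?thesis by simp
    qed
  qed
  ultimately show "insert (\<gamma> - \<beta>) (gap_lengths A \<union> gap_lengths B) \<subseteq> gap_lengths (A \<union> B)"
    by blast
qed

lemma mem_convex_hull_between:
  fixes x y z :: real
  assumes "x \<in> A" "y \<in> A" "x \<le> z" "z \<le> y"
  shows "z \<in> convex hull A"
proof (rule mem_is_interval_1_I[OF _ hull_inc[OF assms(1)] hull_inc[OF assms(2)] assms(3,4)])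
  show "is_interval (convex hull A)"
    unfolding is_interval_convex_1 by (rule convex_convex_hull)
qed

text \<open>
  No other piece can have a point in a gap of \<open>A k\<close>, because the gap lies in the convex hull of
  \<open>A k\<close>.
\<close>

lemma gap_lengths_subset_UN_disjoint_hulls:
  assumes disj: "\<And>i j. i \<in> I \<Longrightarrow> j \<in> I \<Longrightarrow> i \<noteq> j \<Longrightarrow> convex hull (A i) \<inter> convex hull (A j) = {}"
    and k: "k \<in> I"
  shows "gap_lengths (A k) \<subseteq> gap_lengths (\<Union>i\<in>I. A i)"
proof
  fix g assume "g \<in> gap_lengths (A k)"
  then show "g \<in> gap_lengths (\<Union>i\<in>I. A i)"
  proof (cases rule: gap_lengthsE)
    case (1 x y)
    have "y - x \<in> gap_lengths (\<Union>i\<in>I. A i)"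
    proof (rule gap_lengthsI)
      fix z assume z: "z \<in> (\<Union>i\<in>I. A i)" "x < z" "z < y"
      then obtain i where i: "i \<in> I" "z \<in> A i" by blast
      have "z \<in> convex hull (A k)" using 1 z by (intro mem_convex_hull_between[of x _ y]) auto
      then have "i = k" using disj[OF i(1) k] hull_inc[OF i(2)] by blast
      then show False using 1 i z by blast
    qed (use 1 k in auto)
    with 1 show ?thesis by simp
  qed
qed

text \<open>
  A gap that is not a gap of a single piece has its endpoints in different pieces \<open>A i\<close> and \<open>A j\<close>.
  These endpoints are the maximum of \<open>A i\<close> and the minimum of \<open>A j\<close>: otherwise one of the pieces
  would have points on both sides of the gap, and its hull would meet the other piece.  So there is
  at most one such gap for each pair of pieces.
\<close>

lemma finite_gap_lengths_UN_diff:
  fixes A :: "'i \<Rightarrow> real set"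
  assumes "finite I" and comp: "\<And>i. i \<in> I \<Longrightarrow> compact (A i)"
    and disj: "\<And>i j. i \<in> I \<Longrightarrow> j \<in> I \<Longrightarrow> i \<noteq> j \<Longrightarrow> convex hull (A i) \<inter> convex hull (A j) = {}"
  shows "finite (gap_lengths (\<Union>i\<in>I. A i) - (\<Union>i\<in>I. gap_lengths (A i)))"
proof (rule finite_subset)
  show "finite ((\<lambda>(i, j). Inf (A j) - Sup (A i)) ` (I \<times> I))" using assms(1) by simp
  show "gap_lengths (\<Union>i\<in>I. A i) - (\<Union>i\<in>I. gap_lengths (A i))
      \<subseteq> (\<lambda>(i, j). Inf (A j) - Sup (A i)) ` (I \<times> I)"
  proof
    fix g assume g: "g \<in> gap_lengths (\<Union>i\<in>I. A i) - (\<Union>i\<in>I. gap_lengths (A i))"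
    then have "g \<in> gap_lengths (\<Union>i\<in>I. A i)" by blast
    then obtain x y where xy: "g = y - x" "x \<in> (\<Union>i\<in>I. A i)" "y \<in> (\<Union>i\<in>I. A i)" "x < y"
      and none: "\<And>z. z \<in> (\<Union>i\<in>I. A i) \<Longrightarrow> x < z \<Longrightarrow> z < y \<Longrightarrow> False"
      by (rule gap_lengthsE) (rule that)
    obtain i j where i: "i \<in> I" "x \<in> A i" and j: "j \<in> I" "y \<in> A j" using xy by blast
    have "i \<noteq> j"
    proof
      assume "i = j"
      then have "y - x \<in> gap_lengths (A i)"
        using i j xy none by (intro gap_lengthsI) auto
      with g i xy show False by blast
    qed
    then have hulls: "convex hull (A i) \<inter> convex hull (A j) = {}" using disj i j by blast
    have bdd: "bdd_above (A i)" "bdd_below (A j)"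
      using comp[OF i(1)] comp[OF j(1)]
      by (auto intro: compact_imp_bounded bounded_imp_bdd_above bounded_imp_bdd_below)
    have mem: "Sup (A i) \<in> A i" "Inf (A j) \<in> A j"
      using comp[OF i(1)] comp[OF j(1)] i(2) j(2) bdd
      by (auto intro!: closed_contains_Sup closed_contains_Inf compact_imp_closed)
    have le: "x \<le> Sup (A i)" "Inf (A j) \<le> y"
      using i j bdd by (auto intro: cSup_upper cInf_lower)
    have "\<not> x < Sup (A i)"
    proof
      assume "x < Sup (A i)"
      then have "y \<le> Sup (A i)" using none[of "Sup (A i)"] mem i by force
      then have "y \<in> convex hull (A i)"
        using i mem xy by (intro mem_convex_hull_between[of x _ "Sup (A i)"]) auto
      then show False using hulls hull_inc[OF j(2)] by blast
    qed
    moreover have "\<not> Inf (A j) < y"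
    proof
      assume "Inf (A j) < y"
      then have "Inf (A j) \<le> x" using none[of "Inf (A j)"] mem j by force
      then have "x \<in> convex hull (A j)"
        using j mem xy by (intro mem_convex_hull_between[of "Inf (A j)" _ y]) auto
      then show False using hulls hull_inc[OF i(2)] by blast
    qed
    ultimately have "g = Inf (A j) - Sup (A i)" using le xy by simp
    with i j show "g \<in> (\<lambda>(i, j). Inf (A j) - Sup (A i)) ` (I \<times> I)" by force
  qed
qed

section \<open>Gap lengths of attractors with the convex strong separation condition\<close>

lemma contracting_similarity_affine:
  assumes "contracting_similarity f"
  obtains e t where "e \<noteq> 0" "\<bar>e\<bar> < 1" "f = (\<lambda>x. e * x + t)"
proof -
  obtain r where r: "0 < r" "r < 1" and f: "\<And>x y. \<bar>f x - f y\<bar> = r * \<bar>x - y\<bar>"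
    using assms unfolding contracting_similarity_def dist_real_def by blast
  define e where "e = f 1 - f 0"
  have e: "\<bar>e\<bar> = r" using f[of 1 0] by (simp add: e_def)
  \<comment> \<open>Squaring removes the sign: the squared distances of \<open>f x\<close> to \<open>f 0\<close> and \<open>f 1\<close> determine \<open>f x\<close>.\<close>
  have sq: "(f x - f y)\<^sup>2 = e\<^sup>2 * (x - y)\<^sup>2" for x y
  proof -
    have "(f x - f y)\<^sup>2 = (\<bar>f x - f y\<bar>)\<^sup>2" by simp
    also have "\<dots> = (\<bar>e\<bar>)\<^sup>2 * (\<bar>x - y\<bar>)\<^sup>2" unfolding f e by (simp add: power_mult_distrib)
    finally show ?thesis by simp
  qed
  have "f x = e * x + f 0" for x
  proof -
    have "(f x - f 0)\<^sup>2 = e\<^sup>2 * x\<^sup>2" "(f x - f 0 - e)\<^sup>2 = e\<^sup>2 * (x - 1)\<^sup>2"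
      using sq[of x 0] sq[of x 1] by (simp_all add: e_def)
    then have "e * (f x - f 0) = e * (e * x)"
      by (simp add: power2_eq_square algebra_simps)
    then show ?thesis using e r by auto
  qed
  then have "f = (\<lambda>x. e * x + f 0)" by blast
  then show thesis using e r by (intro that[of e "f 0"]) auto
qed

text \<open>
  Self-similarity in terms of gap lengths: the numbers \<open>r i\<close> are the contraction ratios, and the
  exceptional gap lengths are among those of the finitely many gaps between the pieces.  An orientation reversal is invisible
  here, as it preserves lengths.
\<close>

lemma CSSC_attractor_gap_lengths:
  assumes "standard_IFS n S" "is_attractor n S F" "CSSC n S F"
  obtains r :: "nat \<Rightarrow> real" where "\<And>i. i \<in> {1..n} \<Longrightarrow> 0 < r i \<and> r i < 1"
    "\<And>i g. i \<in> {1..n} \<Longrightarrow> g \<in> gap_lengths F \<Longrightarrow> r i * g \<in> gap_lengths F"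
    "finite (gap_lengths F - (\<Union>i\<in>{1..n}. (\<lambda>g. r i * g) ` gap_lengths F))"
proof -
  have "\<forall>i\<in>{1..n}. \<exists>e t. e \<noteq> 0 \<and> \<bar>e\<bar> < 1 \<and> S i = (\<lambda>x. e * x + t)"
    using assms(1) contracting_similarity_affine unfolding standard_IFS_def by metis
  then obtain e t where e: "\<And>i. i \<in> {1..n} \<Longrightarrow> e i \<noteq> 0 \<and> \<bar>e i\<bar> < 1"
    and S: "\<And>i. i \<in> {1..n} \<Longrightarrow> S i = (\<lambda>x. e i * x + t i)"
    by metis
  have F: "compact F" "F = (\<Union>i\<in>{1..n}. S i ` F)"
    using assms(2) unfolding is_attractor_def by auto
  have gaps: "gap_lengths (S i ` F) = (\<lambda>g. \<bar>e i\<bar> * g) ` gap_lengths F" if "i \<in> {1..n}" for i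
    unfolding S[OF that] using gap_lengths_affine_image e[OF that] by blast
  have comp: "compact (S i ` F)" if "i \<in> {1..n}" for i
    unfolding S[OF that] by (intro compact_continuous_image F continuous_intros)
  have hull: "convex hull (S i ` F) = S i ` (convex hull F)" if "i \<in> {1..n}" for i
    using convex_hull_affinity[of "t i" "e i" F] unfolding S[OF that] by (simp add: add.commute)
  have disj: "convex hull (S i ` F) \<inter> convex hull (S j ` F) = {}"
    if "i \<in> {1..n}" "j \<in> {1..n}" "i \<noteq> j" for i j
    using assms(3) that unfolding CSSC_def hull[OF that(1)] hull[OF that(2)] by blast
  show thesis
  proof
    show "0 < \<bar>e i\<bar> \<and> \<bar>e i\<bar> < 1" if "i \<in> {1..n}" for i using e[OF that] by simp
    show "\<bar>e i\<bar> * g \<in> gap_lengths F" if "i \<in> {1..n}" "g \<in> gap_lengths F" for i g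
      using gap_lengths_subset_UN_disjoint_hulls[of "{1..n}" "\<lambda>i. S i ` F" i, OF disj that(1)]
        gaps[OF that(1)] that(2) unfolding F(2)[symmetric] by auto
    have "finite (gap_lengths (\<Union>i\<in>{1..n}. S i ` F) - (\<Union>i\<in>{1..n}. gap_lengths (S i ` F)))"
      by (rule finite_gap_lengths_UN_diff) (use comp disj in auto)
    then show "finite (gap_lengths F - (\<Union>i\<in>{1..n}. (\<lambda>g. \<bar>e i\<bar> * g) ` gap_lengths F))"
      unfolding F(2)[symmetric] using gaps by simp
  qed
qed

section \<open>Gap lengths of the two-vertex attractors\<close>

text \<open>
  The extreme points of the attractors are images of points of the attractors under the four maps,
  and these maps fix 0 or 1.  Since the maps contract, the larger of the two maxima is at most 1, and
  the smaller of the two minima is at least 0; that the points 0 and 1 are attained follows from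
  applying the maps to the extreme points.
\<close>

lemma two_vertex_attractor_extremes:
  assumes p: "unit_interval_params a gu b c gv d"
    and t: "two_vertex_attractors a gu b c gv d Fu Fv"
  shows "0 \<in> Fu" "1 \<in> Fu" "Fu \<subseteq> {0..1}" "0 \<in> Fv" "1 \<in> Fv" "Fv \<subseteq> {0..1}"
proof -
  note P = p[unfolded unit_interval_params_def]
  have gaps: "a + gu = 1 - b" "c + gv = 1 - d" using P by linarith+
  have maps: "S_e1 a = (\<lambda>x. a * x)" "S_e2 a gu b = (\<lambda>x. b * x + (1 - b))"
      "S_e3 c = (\<lambda>x. c * x)" "S_e4 c gv d = (\<lambda>x. d * x + (1 - d))"
    by (simp_all only: fun_eq_iff S_e1_def S_e2_def S_e3_def S_e4_def add.assoc gaps simp_thms)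
  have cpt: "Fu \<noteq> {}" "compact Fu" "Fv \<noteq> {}" "compact Fv"
    and Fu: "Fu = (\<lambda>x. a * x) ` Fu \<union> (\<lambda>x. b * x + (1 - b)) ` Fv"
    and Fv: "Fv = (\<lambda>x. c * x) ` Fv \<union> (\<lambda>x. d * x + (1 - d)) ` Fu"
    using t unfolding two_vertex_attractors_def maps by - (elim conjE, assumption)+
  have P1: "0 < a" "a < 1" "0 < b" "b < 1" "0 < c" "c < 1" "0 < d" "d < 1"
    using P by linarith+
  obtain mu where mu: "mu \<in> Fu" "\<And>x. x \<in> Fu \<Longrightarrow> mu \<le> x"
    using compact_attains_inf[OF cpt(2) cpt(1)] by blast
  obtain Mu where Mu: "Mu \<in> Fu" "\<And>x. x \<in> Fu \<Longrightarrow> x \<le> Mu"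
    using compact_attains_sup[OF cpt(2) cpt(1)] by blast
  obtain mv where mv: "mv \<in> Fv" "\<And>x. x \<in> Fv \<Longrightarrow> mv \<le> x"
    using compact_attains_inf[OF cpt(4) cpt(3)] by blast
  obtain Mv where Mv: "Mv \<in> Fv" "\<And>x. x \<in> Fv \<Longrightarrow> x \<le> Mv"
    using compact_attains_sup[OF cpt(4) cpt(3)] by blast
  have step: "a * x \<in> Fu" "d * x + (1 - d) \<in> Fv" if "x \<in> Fu" for x
    by (subst Fu, use that in blast) (subst Fv, use that in blast)
  have step': "c * x \<in> Fv" "b * x + (1 - b) \<in> Fu" if "x \<in> Fv" for x
    by (subst Fv, use that in blast) (subst Fu, use that in blast)
  have inu: "(\<exists>y\<in>Fu. x = a * y) \<or> (\<exists>z\<in>Fv. x = b * z + (1 - b))" if "x \<in> Fu" for x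
    using that by (subst (asm) Fu) blast
  have inv: "(\<exists>y\<in>Fv. x = c * y) \<or> (\<exists>z\<in>Fu. x = d * z + (1 - d))" if "x \<in> Fv" for x
    using that by (subst (asm) Fv) blast
  \<comment> \<open>Each map is a contraction \<open>y \<mapsto> r * y + (1 - r) * p\<close> towards its fixed point, \<open>p = 0\<close>
    or \<open>p = 1\<close>: an image of \<open>y\<close> that is at least \<open>y\<close> is at most \<open>p\<close>, and
    symmetrically.
    All bounds on the extreme points come from this.\<close>
  have contr: "x \<le> p" if "x \<le> r * y + (1 - r) * p" "y \<le> x" "r < 1" "0 < r" for x y r p :: real
  proof -
    have "r * y \<le> r * x" using that by simp
    then have "(1 - r) * x \<le> (1 - r) * p" using that(1) by (simp add: algebra_simps)
    then show ?thesis using that by simp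
  qed
  have contr': "p \<le> x" if "r * y + (1 - r) * p \<le> x" "x \<le> y" "r < 1" "0 < r" for x y r p :: real
    using contr[of "-x" r "-y" "-p"] that by simp
  have top: "Mu \<le> 1" "Mv \<le> 1"
  proof -
    have u: "Mu \<le> 1" if "Mv \<le> Mu"
      using inu[OF Mu(1)]
    proof (elim disjE bexE)
      fix y assume "y \<in> Fu" "Mu = a * y"
      then show ?thesis using contr[of Mu a y 0] Mu P1 by fastforce
    next
      fix z assume "z \<in> Fv" "Mu = b * z + (1 - b)"
      then show ?thesis using contr[of Mu b z 1] Mv(2)[of z] that P1 by simp
    qed
    have v: "Mv \<le> 1" if "Mu \<le> Mv"
      using inv[OF Mv(1)]
    proof (elim disjE bexE)
      fix y assume "y \<in> Fv" "Mv = c * y"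
      then show ?thesis using contr[of Mv c y 0] Mv P1 by fastforce
    next
      fix z assume "z \<in> Fu" "Mv = d * z + (1 - d)"
      then show ?thesis using contr[of Mv d z 1] Mu(2)[of z] that P1 by simp
    qed
    show "Mu \<le> 1" "Mv \<le> 1" using u v by linarith+
  qed
  have bot: "0 \<le> mu" "0 \<le> mv"
  proof -
    have u: "0 \<le> mu" if "mu \<le> mv"
      using inu[OF mu(1)]
    proof (elim disjE bexE)
      fix y assume "y \<in> Fu" "mu = a * y"
      then show ?thesis using contr'[of a y 0 mu] mu P1 by fastforce
    next
      fix z assume "z \<in> Fv" "mu = b * z + (1 - b)"
      then show ?thesis using contr'[of b z 1 mu] mv(2)[of z] that P1 by simp
    qed
    have v: "0 \<le> mv" if "mv \<le> mu"
      using inv[OF mv(1)]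
    proof (elim disjE bexE)
      fix y assume "y \<in> Fv" "mv = c * y"
      then show ?thesis using contr'[of c y 0 mv] mv P1 by fastforce
    next
      fix z assume "z \<in> Fu" "mv = d * z + (1 - d)"
      then show ?thesis using contr'[of d z 1 mv] mu(2)[of z] that P1 by simp
    qed
    show "0 \<le> mu" "0 \<le> mv" using u v by linarith+
  qed
  show "Fu \<subseteq> {0..1}" "Fv \<subseteq> {0..1}"
    using order_trans[OF bot(1) mu(2)] order_trans[OF Mu(2) top(1)]
      order_trans[OF bot(2) mv(2)] order_trans[OF Mv(2) top(2)] by (simp_all add: subset_iff)
  have "mu \<le> 0" "mv \<le> 0"
    using contr[of mu a mu 0] contr[of mv c mv 0] mu(2)[OF step(1)[OF mu(1)]]
      mv(2)[OF step'(1)[OF mv(1)]] P1 by auto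
  then show "0 \<in> Fu" "0 \<in> Fv" using bot mu(1) mv(1) by simp_all
  have "1 \<le> Mu \<or> 1 \<le> Mv"
    using contr'[of b Mv 1 Mu] contr'[of d Mu 1 Mv] Mu(2)[OF step'(2)[OF Mv(1)]]
      Mv(2)[OF step(2)[OF Mu(1)]] P1 by simp linarith
  then have "Mu = 1 \<or> Mv = 1" using top by linarith
  then have "1 \<in> Fu \<or> 1 \<in> Fv" using Mu(1) Mv(1) by blast
  then show "1 \<in> Fu" "1 \<in> Fv" using step(2)[of 1] step'(2)[of 1] by auto
qed

lemma two_vertex_gap_lengths:
  assumes p: "unit_interval_params a gu b c gv d"
    and t: "two_vertex_attractors a gu b c gv d Fu Fv"
  shows "gap_lengths Fu = insert gu ((\<lambda>g. a * g) ` gap_lengths Fu \<union> (\<lambda>g. b * g) ` gap_lengths Fv)"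
    and "gap_lengths Fv = insert gv ((\<lambda>g. c * g) ` gap_lengths Fv \<union> (\<lambda>g. d * g) ` gap_lengths Fu)"
proof -
  note ext = two_vertex_attractor_extremes[OF assms]
  have step: "gap_lengths ((\<lambda>x. r * x) ` A \<union> (\<lambda>x. s * x + r + g) ` B)
      = insert g ((\<lambda>g. r * g) ` gap_lengths A \<union> (\<lambda>g. s * g) ` gap_lengths B)"
    if "0 < r" "0 < s" "0 < g" "1 \<in> A" "A \<subseteq> {0..1}" "0 \<in> B" "B \<subseteq> {0..1}" for r s g :: real and A B
  proof -
    have "gap_lengths ((\<lambda>x. r * x) ` A \<union> (\<lambda>x. s * x + (r + g)) ` B)
      = insert ((r + g) - r) (gap_lengths ((\<lambda>x. r * x) ` A) \<union> gap_lengths ((\<lambda>x. s * x + (r + g)) ` B))"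
      by (rule gap_lengths_Un_separated) (use that in \<open>force intro: rev_image_eqI\<close>)+
    then show ?thesis
      using gap_lengths_affine_image[of r 0 A] gap_lengths_affine_image[of s "r + g" B] that
      by (simp add: add.assoc)
  qed
  have F: "Fu = (\<lambda>x. a * x) ` Fu \<union> (\<lambda>x. b * x + a + gu) ` Fv"
      "Fv = (\<lambda>x. c * x) ` Fv \<union> (\<lambda>x. d * x + c + gv) ` Fu"
    using t unfolding two_vertex_attractors_def S_e1_def[abs_def] S_e2_def[abs_def]
      S_e3_def[abs_def] S_e4_def[abs_def] by - (elim conjE, assumption)+
  show "gap_lengths Fu = insert gu ((\<lambda>g. a * g) ` gap_lengths Fu \<union> (\<lambda>g. b * g) ` gap_lengths Fv)"
    using step[of a b gu Fu Fv] p ext unfolding F(1)[symmetric] unit_interval_params_def by simp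
  show "gap_lengths Fv = insert gv ((\<lambda>g. c * g) ` gap_lengths Fv \<union> (\<lambda>g. d * g) ` gap_lengths Fu)"
    using step[of c d gv Fv Fu] p ext unfolding F(2)[symmetric] unit_interval_params_def by simp
qed

text \<open>
  The equations for the gap lengths alone do not determine the sets, but every gap length is at most 1
  and each step back along the graph divides it by at most \<open>\<rho> = Max {a, b, c, d} < 1\<close>.  So a gap
  length greater than \<open>\<rho> ^ n\<close> is reached from \<open>gu\<close> or \<open>gv\<close> in fewer than \<open>n\<close> steps, and induction
  on \<open>n\<close> applies.
\<close>

lemma two_vertex_gap_lengths_induct:
  assumes p: "unit_interval_params a gu b c gv d"
    and t: "two_vertex_attractors a gu b c gv d Fu Fv"
    and base: "P gu" "Q gv"
    and step: "\<And>g. P g \<Longrightarrow> P (a * g)" "\<And>g. Q g \<Longrightarrow> P (b * g)"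
      "\<And>g. Q g \<Longrightarrow> Q (c * g)" "\<And>g. P g \<Longrightarrow> Q (d * g)"
  shows "g \<in> gap_lengths Fu \<Longrightarrow> P g" "g \<in> gap_lengths Fv \<Longrightarrow> Q g"
proof -
  note eqs = two_vertex_gap_lengths[OF p t]
  define \<rho> where "\<rho> = Max {a, b, c, d}"
  have \<rho>: "\<rho> < 1" "0 < \<rho>" "a \<le> \<rho>" "b \<le> \<rho>" "c \<le> \<rho>" "d \<le> \<rho>"
    using p unfolding \<rho>_def unit_interval_params_def by (auto simp: less_max_iff_disj)
  have pos: "0 < g" if "g \<in> gap_lengths A" for g A
    using that by (auto elim: gap_lengthsE)
  have small: "g \<le> 1" if "g \<in> gap_lengths A" "A \<subseteq> {0..1}" for g A
    using that(1)
  proof (cases rule: gap_lengthsE)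
    case (1 x y)
    with that(2) have "0 \<le> x" "y \<le> 1" by auto
    with 1 show ?thesis by simp
  qed
  have main: "(g \<in> gap_lengths Fu \<longrightarrow> \<rho> ^ n < g \<longrightarrow> P g) \<and> (g \<in> gap_lengths Fv \<longrightarrow> \<rho> ^ n < g \<longrightarrow> Q g)" for g n
  proof (induction n arbitrary: g)
    case 0
    then show ?case
      using small two_vertex_attractor_extremes[OF p t] by fastforce
  next
    case (Suc n)
    have big: "\<rho> ^ n < h" if "\<rho> ^ Suc n < r * h" "r \<le> \<rho>" "0 < h" for r h
    proof -
      have "\<rho> * \<rho> ^ n < r * h" using that by simp
      also have "\<dots> \<le> \<rho> * h" using that by (intro mult_right_mono) simp_all
      finally show ?thesis using \<rho> by simp
    qed
    have "P g" if g: "g \<in> gap_lengths Fu" and gt: "\<rho> ^ Suc n < g"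
    proof -
      have "g \<in> insert gu ((\<lambda>g. a * g) ` gap_lengths Fu \<union> (\<lambda>g. b * g) ` gap_lengths Fv)"
        using g eqs(1) by (rule eqset_imp_iff[THEN iffD1, rotated])
      then consider (gap) "g = gu" | (left) h where "h \<in> gap_lengths Fu" "g = a * h"
        | (right) h where "h \<in> gap_lengths Fv" "g = b * h"
        by (elim insertE UnE imageE)
      then show ?thesis
      proof cases
        case gap
        then show ?thesis using base by simp
      next
        case (left h)
        then have "\<rho> ^ n < h" using big[of a h] gt \<rho> pos by blast
        then show ?thesis using left Suc.IH step by blast
      next
        case (right h)
        then have "\<rho> ^ n < h" using big[of b h] gt \<rho> pos by blast
        then show ?thesis using right Suc.IH step by blast
      qed
    qed
    moreover have "Q g" if g: "g \<in> gap_lengths Fv" and gt: "\<rho> ^ Suc n < g"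
    proof -
      have "g \<in> insert gv ((\<lambda>g. c * g) ` gap_lengths Fv \<union> (\<lambda>g. d * g) ` gap_lengths Fu)"
        using g eqs(2) by (rule eqset_imp_iff[THEN iffD1, rotated])
      then consider (gap) "g = gv" | (left) h where "h \<in> gap_lengths Fv" "g = c * h"
        | (right) h where "h \<in> gap_lengths Fu" "g = d * h"
        by (elim insertE UnE imageE)
      then show ?thesis
      proof cases
        case gap
        then show ?thesis using base by simp
      next
        case (left h)
        then have "\<rho> ^ n < h" using big[of c h] gt \<rho> pos by blast
        then show ?thesis using left Suc.IH step by blast
      next
        case (right h)
        then have "\<rho> ^ n < h" using big[of d h] gt \<rho> pos by blast
        then show ?thesis using right Suc.IH step by blast
      qed
    qed
    ultimately show ?case by blast
  qed
  have "\<exists>n. \<rho> ^ n < g" if "0 < g" for g using real_arch_pow_inv[OF that \<rho>(1)] .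
  then show "g \<in> gap_lengths Fu \<Longrightarrow> P g" "g \<in> gap_lengths Fv \<Longrightarrow> Q g"
    using main pos by blast+
qed

section \<open>Exponents of the gap lengths\<close>

lemma mult_rat_independent_monomial_inject:
  fixes us :: "real list" and e f :: "nat \<Rightarrow> nat"
  assumes "mult_rat_independent us"
    and eq: "(\<Prod>i<length us. us ! i ^ e i) = (\<Prod>i<length us. us ! i ^ f i)"
    and "i < length us"
  shows "e i = f i"
proof -
  have nz: "us ! i \<noteq> 0" if "i < length us" for i
    using assms(1) that unfolding mult_rat_independent_def by (metis less_irrefl nth_mem)
  have indep: "(\<Prod>i<length us. us ! i powi m i) = 1 \<Longrightarrow> \<forall>i<length us. m i = 0" for m :: "nat \<Rightarrow> int"
    using assms(1) unfolding mult_rat_independent_def by blast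
  have "(\<Prod>i<length us. us ! i powi (int (e i) - int (f i)))
      = (\<Prod>i<length us. us ! i ^ e i / us ! i ^ f i)"
    by (rule prod.cong) (simp_all add: nz power_int_diff)
  also have "\<dots> = 1"
    using nz by (simp add: prod_dividef eq)
  finally have "int (e i) - int (f i) = 0"
    using indep[of "\<lambda>i. int (e i) - int (f i)"] assms(3) by blast
  then show ?thesis by simp
qed

lemma mult_rat_independent_6_inject:
  assumes "mult_rat_independent [gu, gv, a, b, c, d]"
    and "gu ^ p * gv ^ q * a ^ i * b ^ j * c ^ k * d ^ l
       = gu ^ p' * gv ^ q' * a ^ i' * b ^ j' * c ^ k' * d ^ l'"
  shows "p = p' \<and> q = q' \<and> i = i' \<and> j = j' \<and> k = k' \<and> l = l'"
proof -
  let ?us = "[gu, gv, a, b, c, d]"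
  have "[p, q, i, j, k, l] ! n = [p', q', i', j', k', l'] ! n" if "n < 6" for n
    using mult_rat_independent_monomial_inject[OF assms(1), of "(!) [p, q, i, j, k, l]"
        "(!) [p', q', i', j', k', l']" n] that assms(2)
    by (simp add: lessThan_Suc numeral_eq_Suc mult_ac)
  from this[of 0] this[of 1] this[of 2] this[of 3] this[of 4] this[of 5] show ?thesis
    by simp
qed

text \<open>
  The exponents count the edges of a path from \<open>u\<close>.  The predicate \<open>Q\<close> for paths from \<open>v\<close> can be
  cruder, because a path from \<open>u\<close> to \<open>v\<close> has used \<open>b\<close>, after which the loop \<open>c\<close> is available.
\<close>

lemma two_vertex_gap_length_monomial:
  assumes p: "unit_interval_params a gu b c gv d"
    and t: "two_vertex_attractors a gu b c gv d Fu Fv"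
    and g: "g \<in> gap_lengths Fu"
  shows "(\<exists>i j k. g = gu * a ^ i * b ^ j * c ^ k * d ^ j \<and> (j = 0 \<longrightarrow> k = 0))
       \<or> (\<exists>i j k. g = gv * a ^ i * b ^ Suc j * c ^ k * d ^ j)"
proof -
  define P where "P g \<longleftrightarrow> (\<exists>i j k. g = gu * a ^ i * b ^ j * c ^ k * d ^ j \<and> (j = 0 \<longrightarrow> k = 0))
       \<or> (\<exists>i j k. g = gv * a ^ i * b ^ Suc j * c ^ k * d ^ j)" for g
  define Q where "Q g \<longleftrightarrow> (\<exists>i j k. g = gu * a ^ i * b ^ j * c ^ k * d ^ Suc j)
       \<or> (\<exists>i j k. g = gv * a ^ i * b ^ j * c ^ k * d ^ j)" for g
  have Pu: "P (gu * a ^ i * b ^ j * c ^ k * d ^ j)" if "j = 0 \<longrightarrow> k = 0" for i j k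
    using that unfolding P_def by blast
  have Pv: "P (gv * a ^ i * b ^ Suc j * c ^ k * d ^ j)" for i j k
    unfolding P_def by blast
  have Qu: "Q (gu * a ^ i * b ^ j * c ^ k * d ^ Suc j)" for i j k
    unfolding Q_def by blast
  have Qv: "Q (gv * a ^ i * b ^ j * c ^ k * d ^ j)" for i j k
    unfolding Q_def by blast
  have base: "P gu" "Q gv" using Pu[of 0 0 0] Qv[of 0 0 0] by simp_all
  have "P (a * g)" if "P g" for g
    using that unfolding P_def[of g]
  proof (elim disjE exE conjE)
    fix i j k assume "g = gu * a ^ i * b ^ j * c ^ k * d ^ j" "j = 0 \<longrightarrow> k = 0"
    then show ?thesis using Pu[of j k "Suc i"] by (simp add: mult_ac)
  next
    fix i j k assume "g = gv * a ^ i * b ^ Suc j * c ^ k * d ^ j"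
    then show ?thesis using Pv[of "Suc i" j k] by (simp add: mult_ac)
  qed
  moreover have "P (b * g)" if "Q g" for g
    using that unfolding Q_def[of g]
  proof (elim disjE exE)
    fix i j k assume "g = gu * a ^ i * b ^ j * c ^ k * d ^ Suc j"
    then show ?thesis using Pu[of "Suc j" k i] by (simp add: mult_ac)
  next
    fix i j k assume "g = gv * a ^ i * b ^ j * c ^ k * d ^ j"
    then show ?thesis using Pv[of i j k] by (simp add: mult_ac)
  qed
  moreover have "Q (c * g)" if "Q g" for g
    using that unfolding Q_def[of g]
  proof (elim disjE exE)
    fix i j k assume "g = gu * a ^ i * b ^ j * c ^ k * d ^ Suc j"
    then show ?thesis using Qu[of i j "Suc k"] by (simp add: mult_ac)
  next
    fix i j k assume "g = gv * a ^ i * b ^ j * c ^ k * d ^ j"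
    then show ?thesis using Qv[of i j "Suc k"] by (simp add: mult_ac)
  qed
  moreover have "Q (d * g)" if "P g" for g
    using that unfolding P_def[of g]
  proof (elim disjE exE conjE)
    fix i j k assume "g = gu * a ^ i * b ^ j * c ^ k * d ^ j"
    then show ?thesis using Qu[of i j k] by (simp add: mult_ac)
  next
    fix i j k assume "g = gv * a ^ i * b ^ Suc j * c ^ k * d ^ j"
    then show ?thesis using Qv[of i "Suc j" k] by (simp add: mult_ac)
  qed
  ultimately have "P g"
    using two_vertex_gap_lengths_induct(1)[OF p t, of P Q] base g by blast
  then show ?thesis unfolding P_def .
qed

text \<open>
  If \<open>r\<close> is not the ratio of a closed path at \<open>u\<close>, then \<open>r * gu\<close> is of the form with \<open>gv\<close>, so
  \<open>r\<close> contains the factor \<open>gv / gu\<close>.  Then \<open>r * (b * gv)\<close> contains \<open>gv\<^sup>2 / gu\<close>, which occurs in no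
  gap length.
\<close>

lemma two_vertex_gap_scaling_monomial:
  assumes p: "unit_interval_params a gu b c gv d"
    and t: "two_vertex_attractors a gu b c gv d Fu Fv"
    and ind: "mult_rat_independent [gu, gv, a, b, c, d]"
    and r: "\<And>g. g \<in> gap_lengths Fu \<Longrightarrow> r * g \<in> gap_lengths Fu"
  shows "\<exists>i j k. r = a ^ i * b ^ j * c ^ k * d ^ j \<and> (j = 0 \<longrightarrow> k = 0)"
proof -
  have pos: "gu \<noteq> 0" "gv \<noteq> 0" using p unfolding unit_interval_params_def by auto
  have "gu \<in> gap_lengths Fu" "b * gv \<in> gap_lengths Fu"
    using two_vertex_gap_lengths[OF p t] by blast+
  note rg = this[THEN r]
  from two_vertex_gap_length_monomial[OF p t rg(1)] show ?thesis
  proof (elim disjE exE conjE)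
    fix i j k assume "r * gu = gu * a ^ i * b ^ j * c ^ k * d ^ j" "j = 0 \<longrightarrow> k = 0"
    then show ?thesis using pos by (auto simp: mult_ac)
  next
    fix i j k assume 1: "r * gu = gv * a ^ i * b ^ Suc j * c ^ k * d ^ j"
    have two: "gu * (r * (b * gv)) = b * gv * (gv * a ^ i * b ^ Suc j * c ^ k * d ^ j)"
      unfolding 1[symmetric] by (simp add: mult_ac)
    from two_vertex_gap_length_monomial[OF p t rg(2)] show ?thesis
    proof (elim disjE exE conjE)
      fix i' j' k' assume h: "r * (b * gv) = gu * a ^ i' * b ^ j' * c ^ k' * d ^ j'"
      have "gu ^ 2 * gv ^ 0 * a ^ i' * b ^ j' * c ^ k' * d ^ j'
          = gu ^ 0 * gv ^ 2 * a ^ i * b ^ (j + 2) * c ^ k * d ^ j"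
        using two unfolding h by (simp add: mult_ac power2_eq_square)
      from mult_rat_independent_6_inject[OF ind this] show ?thesis by simp
    next
      fix i' j' k' assume h: "r * (b * gv) = gv * a ^ i' * b ^ Suc j' * c ^ k' * d ^ j'"
      have "gu ^ 1 * gv ^ 1 * a ^ i' * b ^ Suc j' * c ^ k' * d ^ j'
          = gu ^ 0 * gv ^ 2 * a ^ i * b ^ (j + 2) * c ^ k * d ^ j"
        using two unfolding h by (simp add: mult_ac power2_eq_square)
      from mult_rat_independent_6_inject[OF ind this] show ?thesis by simp
    qed
  qed
qed

text \<open>
  A closed path at \<open>u\<close> must pass through \<open>b\<close> in order to use \<open>c\<close>, but the only \<open>b\<close> on the left-hand
  side is needed for the factor \<open>gv\<close> of \<open>g\<close>.
\<close>

lemma b_gv_powers_of_c_not_rescaled_gap: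
  assumes p: "unit_interval_params a gu b c gv d"
    and t: "two_vertex_attractors a gu b c gv d Fu Fv"
    and ind: "mult_rat_independent [gu, gv, a, b, c, d]"
    and r: "\<And>g. g \<in> gap_lengths Fu \<Longrightarrow> r * g \<in> gap_lengths Fu" "r < 1"
    and g: "g \<in> gap_lengths Fu"
  shows "b * (gv * c ^ n) \<noteq> r * g"
proof
  assume eq: "b * (gv * c ^ n) = r * g"
  obtain i j k where r': "r = a ^ i * b ^ j * c ^ k * d ^ j" "j = 0 \<longrightarrow> k = 0"
    using two_vertex_gap_scaling_monomial[OF p t ind r(1)] by blast
  from two_vertex_gap_length_monomial[OF p t g] show False
  proof (elim disjE exE conjE)
    fix i' j' k' assume "g = gu * a ^ i' * b ^ j' * c ^ k' * d ^ j'"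
    with eq r' have "gu ^ 0 * gv ^ 1 * a ^ 0 * b ^ 1 * c ^ n * d ^ 0
        = gu ^ 1 * gv ^ 0 * a ^ (i + i') * b ^ (j + j') * c ^ (k + k') * d ^ (j + j')"
      by (simp add: mult_ac power_add)
    from mult_rat_independent_6_inject[OF ind this] show False by simp
  next
    fix i' j' k' assume "g = gv * a ^ i' * b ^ Suc j' * c ^ k' * d ^ j'"
    with eq r' have "gu ^ 0 * gv ^ 1 * a ^ 0 * b ^ 1 * c ^ n * d ^ 0
        = gu ^ 0 * gv ^ 1 * a ^ (i + i') * b ^ (j + Suc j') * c ^ (k + k') * d ^ (j + j')"
      by (simp add: mult_ac power_add)
    from mult_rat_independent_6_inject[OF ind this] have "i = 0" "j = 0" by simp_all
    with r' have "r = 1" by simp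
    with r(2) show False by simp
  qed
qed

theorem corollary6p4:
  fixes a gu b c gv d :: real and Fu Fv :: "real set"
  assumes "unit_interval_params a gu b c gv d"
    and "two_vertex_attractors a gu b c gv d Fu Fv"
    and "mult_rat_independent [gu, gv, a, b, c, d]"
  shows "\<not> (\<exists>n S. standard_IFS n S \<and> is_attractor n S Fu \<and> CSSC n S Fu)"
proof
  assume "\<exists>n S. standard_IFS n S \<and> is_attractor n S Fu \<and> CSSC n S Fu"
  then obtain N :: nat and r :: "nat \<Rightarrow> real"
    where r: "\<And>i. i \<in> {1..N} \<Longrightarrow> 0 < r i \<and> r i < 1"
      "\<And>i g. i \<in> {1..N} \<Longrightarrow> g \<in> gap_lengths Fu \<Longrightarrow> r i * g \<in> gap_lengths Fu"
      "finite (gap_lengths Fu - (\<Union>i\<in>{1..N}. (\<lambda>g. r i * g) ` gap_lengths Fu))"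
    by (elim exE conjE) (erule (2) CSSC_attractor_gap_lengths, blast)
  note pos = assms(1)[unfolded unit_interval_params_def]
  note eqs = two_vertex_gap_lengths[OF assms(1,2)]
  have "gv * c ^ n \<in> gap_lengths Fv" for n
  proof (induction n)
    case (Suc n)
    then have "c * (gv * c ^ n) \<in> gap_lengths Fv" using eqs(2) by blast
    then show ?case by (simp add: mult_ac)
  next
    case 0
    show ?case by (subst eqs(2)) simp
  qed
  then have "b * (gv * c ^ n) \<in> gap_lengths Fu" for n using eqs(1) by blast
  moreover have "b * (gv * c ^ n) \<noteq> r i * g" if "i \<in> {1..N}" "g \<in> gap_lengths Fu" for n i g
    using b_gv_powers_of_c_not_rescaled_gap[OF assms, of "r i"] r that by blast
  ultimately have "range (\<lambda>n. b * (gv * c ^ n))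
      \<subseteq> gap_lengths Fu - (\<Union>i\<in>{1..N}. (\<lambda>g. r i * g) ` gap_lengths Fu)"
    by (intro image_subsetI DiffI) auto
  then have "finite (range (\<lambda>n. b * (gv * c ^ n)))" by (rule finite_subset) (rule r(3))
  moreover have "inj (\<lambda>n. b * (gv * c ^ n))"
  proof (rule injI)
    fix m n assume "b * (gv * c ^ m) = b * (gv * c ^ n)"
    moreover have "0 < b" "0 < gv" "0 < c" "c < 1" using pos by linarith+
    ultimately show "m = n" by (simp add: power_inject_exp')
  qed
  ultimately show False using finite_imageD[of _ UNIV] infinite_UNIV_nat by blast
qed

end
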